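(* Let $a>0$. The unique stationary solution $(u_\infty,\tau_\infty,f_\infty)\in (H^1(\Omega))^3$ of the system $$\rho\,\partial_t u=\eta\,\partial_{yy}u+\partial_y\tau,\qquad \lambda\,\partial_t\tau=G\,\partial_y u-f\tau,\qquad \partial_t f=(-1+\xi|\tau|)f^2-\nu f^3,$$ with boundary conditions $u_\infty(0)=0$ and $u_\infty(1)=a$, satisfying $f_\infty>0$ everywhere on $\Omega$, is $$(u_\infty,\tau_\infty,f_\infty)(y)=\left(ay,\ \frac{\sqrt{1+4\nu\xi Ga}+1}{2\xi},\ \frac{\sqrt{1+4\nu\xi Ga}-1}{2\nu}\right).$$
   Context: $\Omega=[0,1]$ with space variable $y$; $\rho,\eta,\lambda,G,\xi,\nu$ are positive constants. A stationary solution is a time-independent triple of real-valued functions on $\Omega$ satisfying the system with all time derivatives equal to zero, i.e. $0=\eta\,u_\infty''+\tau_\infty'$ (in the sense of distributions), $0=G\,u_\infty'-f_\infty\tau_\infty$, and $0=(-1+\xi|\tau_\infty|)f_\infty^2-\nu f_\infty^3$. *)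

theory Defs
  imports "HOL-Analysis.Analysis"
begin

text \<open>Functions on the unit interval are total functions of which only the values on \<open>{0..1}\<close> matter.\<close>

definition square_integrable :: "(real \<Rightarrow> real) \<Rightarrow> bool" where
  "square_integrable v \<longleftrightarrow>
     v \<in> borel_measurable (lebesgue_on {0..1}) \<and>
     integrable (lebesgue_on {0..1}) (\<lambda>y. (v y)\<^sup>2)"

definition test_function :: "(real \<Rightarrow> real) \<Rightarrow> bool" where
  "test_function \<phi> \<longleftrightarrow>
     (\<forall>n y. (deriv ^^ n) \<phi> field_differentiable at y) \<and>
     closure {y. \<phi> y \<noteq> 0} \<subseteq> {0<..<1}"

definition weak_deriv_L2 :: "(real \<Rightarrow> real) \<Rightarrow> (real \<Rightarrow> real) \<Rightarrow> bool" where
  "weak_deriv_L2 v g \<longleftrightarrow>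
     square_integrable g \<and>
     (\<forall>\<phi>. test_function \<phi> \<longrightarrow>
        (LINT y|lebesgue_on {0..1}. v y * deriv \<phi> y) = - (LINT y|lebesgue_on {0..1}. g y * \<phi> y))"

text \<open>A class in the Sobolev space \<open>H\<^sup>1(0,1)\<close> has exactly one representative that is continuous on
  \<open>{0..1}\<close>. It is the one meant by boundary values and by conditions required everywhere,
  so \<open>H1\<close> consists of these representatives.\<close>

definition H1 :: "(real \<Rightarrow> real) set" where
  "H1 = {v. continuous_on {0..1} v \<and> square_integrable v \<and> (\<exists>g. weak_deriv_L2 v g)}"

text \<open>The system at a fixed time: \<open>ut\<close>, \<open>\<tau>t\<close>, \<open>ft\<close> are the values of the time derivatives of
  \<open>u\<close>, \<open>\<tau>\<close>, \<open>f\<close>. The first equation is read in the sense of distributions, the others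
  almost everywhere, with the weak derivative of \<open>u\<close>. Meant for square integrable arguments, for
  which all integrals below exist.\<close>

definition satisfies_system ::
  "real \<Rightarrow> real \<Rightarrow> real \<Rightarrow> real \<Rightarrow> real \<Rightarrow> real \<Rightarrow>
   (real \<Rightarrow> real) \<Rightarrow> (real \<Rightarrow> real) \<Rightarrow> (real \<Rightarrow> real) \<Rightarrow>
   (real \<Rightarrow> real) \<Rightarrow> (real \<Rightarrow> real) \<Rightarrow> (real \<Rightarrow> real) \<Rightarrow> bool" where
  "satisfies_system \<rho> \<eta> lam G \<xi> \<nu> ut \<tau>t ft u \<tau> f \<longleftrightarrow>
     (\<forall>\<phi>. test_function \<phi> \<longrightarrow>
        \<rho> * (LINT y|lebesgue_on {0..1}. ut y * \<phi> y) =
          \<eta> * (LINT y|lebesgue_on {0..1}. u y * deriv (deriv \<phi>) y)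
          - (LINT y|lebesgue_on {0..1}. \<tau> y * deriv \<phi> y)) \<and>
     (\<exists>u'. weak_deriv_L2 u u' \<and>
        (AE y in lebesgue_on {0..1}. lam * \<tau>t y = G * u' y - f y * \<tau> y)) \<and>
     (AE y in lebesgue_on {0..1}. ft y = (-1 + \<xi> * \<bar>\<tau> y\<bar>) * (f y)\<^sup>2 - \<nu> * (f y) ^ 3)"

definition stationary_solution ::
  "real \<Rightarrow> real \<Rightarrow> real \<Rightarrow> real \<Rightarrow> real \<Rightarrow> real \<Rightarrow>
   (real \<Rightarrow> real) \<Rightarrow> (real \<Rightarrow> real) \<Rightarrow> (real \<Rightarrow> real) \<Rightarrow> bool" where
  "stationary_solution \<rho> \<eta> lam G \<xi> \<nu> u \<tau> f \<longleftrightarrow>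
     satisfies_system \<rho> \<eta> lam G \<xi> \<nu> (\<lambda>_. 0) (\<lambda>_. 0) (\<lambda>_. 0) u \<tau> f"

end

theory Submission
  imports Defs
begin

text \<open>The idea is to turn the weak formulation into pointwise equations between continuous
  functions. The second equation identifies the weak derivative of \<open>u\<close> with the continuous function
  \<open>h = f \<tau> / G\<close>. Inserting \<open>deriv \<phi>\<close> for the test function turns the second-order term of the
  momentum balance into \<open>- \<eta> \<integral> h \<phi>'\<close>, so \<open>\<eta> h + \<tau>\<close> integrates to zero against the derivative of every
  test function and hence is a constant \<open>C\<close> (lemma \<open>du_Bois_Reymond\<close>). The third equation
  holds almost everywhere between continuous functions, hence everywhere, and as \<open>f > 0\<close> it reads
  \<open>\<xi> \<bar>\<tau>\<bar> = 1 + \<nu> f\<close>.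

  Taking absolute values in \<open>\<tau> (\<eta> f / G + 1) = C\<close> gives
  \<open>(1 + \<nu> f) (\<eta> f / G + 1) = \<xi> \<bar>C\<bar>\<close>. The left-hand side increases strictly in \<open>f > 0\<close>, so the value
  of \<open>f\<close>, and with it that of \<open>\<tau>\<close>, is the same at all points (lemma
  \<open>stress_fluidity_determined\<close>). Then \<open>h\<close> is constant, \<open>u\<close> is affine, and the boundary values force
  \<open>h = a\<close>. This yields \<open>f \<tau> = G a\<close>, so \<open>\<tau> > 0\<close>, and \<open>f\<close> is the positive root of
  \<open>\<nu> f\<^sup>2 + f = \<xi> G a\<close>. Conversely, the explicit triple satisfies the equations because affine
  functions have their classical derivatives as weak derivatives.

  The analytic part is the lemma of du Bois-Reymond. To compare the values of \<open>w\<close> at two interior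
  points \<open>s\<close> and \<open>t\<close> it needs a test function whose derivative is a bump at \<open>s\<close> minus the same
  bump at \<open>t\<close>; such a function is the difference of two translates of a smooth transition
  function, built from \<open>exp (- 1 / s)\<close>.\<close>

section \<open>Smooth transition functions\<close>

text \<open>Smoothness by coinduction: all iterated derivatives stay in a set that is closed under
  differentiation. This spares explicit formulas for higher derivatives.\<close>

lemma deriv_closed_imp_smooth:
  fixes f :: "real \<Rightarrow> real"
  assumes "f \<in> A"
    and closed: "\<And>g. g \<in> A \<Longrightarrow> \<exists>g'\<in>A. \<forall>x. (g has_real_derivative g' x) (at x)"
  shows "(deriv ^^ n) f field_differentiable at y"
proof -
  have step: "deriv g \<in> A" if "g \<in> A" for g
  proof -
    from closed[OF that] obtain g' where "g' \<in> A" "\<forall>x. (g has_real_derivative g' x) (at x)"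
      by blast
    moreover from this have "deriv g = g'"
      by (intro ext DERIV_imp_deriv) blast
    ultimately show ?thesis by simp
  qed
  have "(deriv ^^ n) f \<in> A"
    by (induction n) (auto simp: assms(1) step)
  from closed[OF this] show ?thesis
    unfolding field_differentiable_def by blast
qed

text \<open>The powers of \<open>inverse s\<close> are the factors that repeated differentiation of the flat function
  \<open>exp (- 1 / s)\<close> brings in.\<close>

definition flat :: "nat \<Rightarrow> real \<Rightarrow> real" where
  "flat k s = (if s > 0 then exp (- inverse s) * inverse s ^ k else 0)"

lemma flat_nonneg: "0 \<le> flat k s"
  by (simp add: flat_def)

lemma flat_pos_iff: "0 < flat k s \<longleftrightarrow> 0 < s"
  by (simp add: flat_def)

lemma flat_mult_power: "s ^ j * flat (k + j) s = flat k s"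
  by (simp add: flat_def power_add field_simps)

lemma flat_tendsto_0: "(flat k \<longlongrightarrow> 0) (at 0)"
proof -
  have "((\<lambda>s. inverse s ^ k / exp (inverse s)) \<longlongrightarrow> (0::real)) (at_right 0)"
    by (rule filterlim_compose[OF tendsto_power_div_exp_0 filterlim_inverse_at_top_right])
  moreover have "\<forall>\<^sub>F s in at_right 0. inverse s ^ k / exp (inverse s) = flat k s"
    using eventually_at_right_less[of 0]
    by eventually_elim (simp add: flat_def exp_minus field_simps)
  ultimately have right: "(flat k \<longlongrightarrow> 0) (at_right 0)"
    by (rule Lim_transform_eventually)
  have "\<forall>\<^sub>F s in at_left 0. 0 = flat k s"
    by (auto simp: eventually_at_filter flat_def)
  then have "(flat k \<longlongrightarrow> 0) (at_left 0)"
    by (rule Lim_transform_eventually[OF tendsto_const])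
  with right show ?thesis
    by (simp add: filterlim_split_at)
qed

text \<open>At the origin the difference quotient of \<open>flat k\<close> is \<open>flat (k + 1)\<close>, which tends to zero; thus
  one formula describes the derivative on the whole line.\<close>

lemma DERIV_flat:
  "(flat k has_real_derivative flat (k + 2) s - real k * flat (k + 1) s) (at s)"
proof (cases s "0::real" rule: linorder_cases)
  case less
  have "((\<lambda>_. 0) has_real_derivative 0) (at s)" by simp
  then have "(flat k has_real_derivative 0) (at s)"
    by (rule has_field_derivative_transform_within_open[of _ _ _ "{..<0}"])
       (use less in \<open>auto simp: flat_def\<close>)
  then show ?thesis using less by (simp add: flat_def)
next
  case equal
  have "\<forall>\<^sub>F h in at 0. flat (k + 1) h = flat k h / h"
    by (auto simp: eventually_at_filter flat_def field_simps)
  then have "((\<lambda>h. flat k h / h) \<longlongrightarrow> 0) (at 0)"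
    by (rule Lim_transform_eventually[OF flat_tendsto_0])
  then have "(flat k has_real_derivative 0) (at 0)"
    by (simp add: DERIV_def flat_def)
  then show ?thesis using equal by (simp add: flat_def)
next
  case greater
  have inv: "(inverse has_real_derivative - (inverse s ^ 2)) (at s)"
    using DERIV_inverse[of s UNIV] greater by (simp add: numeral_2_eq_2)
  have pow: "((\<lambda>s. inverse s ^ k) has_real_derivative - (real k * inverse s ^ (k + 1))) (at s)"
    by (rule DERIV_cong[OF DERIV_power[OF inv]]) (cases k; simp add: power2_eq_square)
  have exp: "((\<lambda>s. exp (- inverse s)) has_real_derivative exp (- inverse s) * inverse s ^ 2) (at s)"
    by (rule DERIV_cong[OF DERIV_chain2[OF DERIV_exp DERIV_minus[OF inv]]]) simp
  have "((\<lambda>s. exp (- inverse s) * inverse s ^ k) has_real_derivative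
      flat (k + 2) s - real k * flat (k + 1) s) (at s)"
    by (rule DERIV_cong[OF DERIV_mult[OF exp pow]])
      (use greater in \<open>simp add: flat_def power_add power2_eq_square algebra_simps\<close>)
  then show ?thesis
    by (rule has_field_derivative_transform_within_open[of _ _ _ "{0<..}"])
       (use greater in \<open>auto simp: flat_def\<close>)
qed

text \<open>The bump \<open>flat 0 (e\<^sup>2 - x\<^sup>2)\<close>, which is positive exactly for \<open>\<bar>x\<bar> < e\<close>, together with enough
  functions vanishing outside that interval to contain all its derivatives.\<close>

definition bump_terms :: "real \<Rightarrow> (real \<Rightarrow> real) set" where
  "bump_terms e = {\<lambda>x. poly p x * flat k (e\<^sup>2 - x\<^sup>2) | p k. True}"

lemma bump_in_bump_terms: "(\<lambda>x. flat 0 (e\<^sup>2 - x\<^sup>2)) \<in> bump_terms e"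
  unfolding bump_terms_def by (rule CollectI, rule exI[of _ 1], rule exI[of _ 0]) simp

text \<open>With \<open>q x = e\<^sup>2 - x\<^sup>2\<close>, the chain rule produces \<open>flat k\<close>, \<open>flat (k + 1)\<close> and
  \<open>flat (k + 2)\<close> of \<open>q x\<close>. The first two are \<open>q\<^sup>2\<close> and \<open>q\<close> times the third, so the three summands
  merge into one polynomial times \<open>flat (k + 2)\<close>.\<close>

lemma bump_terms_deriv_closed:
  assumes "g \<in> bump_terms e"
  shows "\<exists>g'\<in>bump_terms e. \<forall>x. (g has_real_derivative g' x) (at x)"
proof -
  from assms obtain p k where g: "g = (\<lambda>x. poly p x * flat k (e\<^sup>2 - x\<^sup>2))"
    by (auto simp: bump_terms_def)
  define q :: "real poly" where "q = [:e\<^sup>2, 0, -1:]"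
  have q: "poly q x = e\<^sup>2 - x\<^sup>2" for x
    by (simp add: q_def power2_eq_square)
  define p' where "p' = pderiv p * q\<^sup>2 - p * [:0, 2:] * (1 - smult (real k) q)"
  have "(g has_real_derivative poly p' x * flat (k + 2) (e\<^sup>2 - x\<^sup>2)) (at x)" for x
  proof -
    have "((\<lambda>x. flat k (e\<^sup>2 - x\<^sup>2)) has_real_derivative
        (flat (k + 2) (e\<^sup>2 - x\<^sup>2) - real k * flat (k + 1) (e\<^sup>2 - x\<^sup>2)) * (- 2 * x)) (at x)"
      by (rule DERIV_chain2[OF DERIV_flat]) (auto intro!: derivative_eq_intros)
    from DERIV_mult[OF poly_DERIV this]
    have prod: "(g has_real_derivative poly (pderiv p) x * flat k (e\<^sup>2 - x\<^sup>2) +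
        (flat (k + 2) (e\<^sup>2 - x\<^sup>2) - real k * flat (k + 1) (e\<^sup>2 - x\<^sup>2)) * (- 2 * x) * poly p x) (at x)"
      by (simp add: g)
    have flats: "flat k (e\<^sup>2 - x\<^sup>2) = (e\<^sup>2 - x\<^sup>2)\<^sup>2 * flat (k + 2) (e\<^sup>2 - x\<^sup>2)"
      "flat (k + 1) (e\<^sup>2 - x\<^sup>2) = (e\<^sup>2 - x\<^sup>2) * flat (k + 2) (e\<^sup>2 - x\<^sup>2)"
      using flat_mult_power[of "e\<^sup>2 - x\<^sup>2" 2 k] flat_mult_power[of "e\<^sup>2 - x\<^sup>2" 1 "k + 1"]
      by simp_all
    have "poly (pderiv p) x * flat k (e\<^sup>2 - x\<^sup>2) +
        (flat (k + 2) (e\<^sup>2 - x\<^sup>2) - real k * flat (k + 1) (e\<^sup>2 - x\<^sup>2)) * (- 2 * x) * poly p x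
        = poly p' x * flat (k + 2) (e\<^sup>2 - x\<^sup>2)"
      unfolding flats by (simp add: p'_def q algebra_simps)
    with prod show ?thesis by simp
  qed
  moreover have "(\<lambda>x. poly p' x * flat (k + 2) (e\<^sup>2 - x\<^sup>2)) \<in> bump_terms e"
    unfolding bump_terms_def by blast
  ultimately show ?thesis by (intro bexI) auto
qed

text \<open>An antiderivative of the bump, and therefore constant on each side of the support of the bump.\<close>

lemma smooth_transition_exists:
  fixes e :: real
  assumes "e > 0"
  obtains B :: "real \<Rightarrow> real" where
    "\<And>x. (B has_real_derivative flat 0 (e\<^sup>2 - x\<^sup>2)) (at x)"
    "\<And>x. x \<le> - e \<Longrightarrow> B x = B (- e)"
    "\<And>x. e \<le> x \<Longrightarrow> B x = B e"
proof -
  from bump_terms_deriv_closed[OF bump_in_bump_terms]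
  have cont: "isCont (\<lambda>x. flat 0 (e\<^sup>2 - x\<^sup>2)) x" for x
    by (blast intro: DERIV_isCont)
  obtain B where B': "\<And>x. (B has_real_derivative flat 0 (e\<^sup>2 - x\<^sup>2)) (at x)"
    using einterval_antiderivative[of "-\<infinity>" "\<infinity>" "\<lambda>x. flat 0 (e\<^sup>2 - x\<^sup>2)"] cont
    by (auto simp: has_real_derivative_iff_has_vector_derivative)
  have outside: "(B has_real_derivative 0) (at x)" if "e \<le> \<bar>x\<bar>" for x
  proof -
    have "e\<^sup>2 \<le> x\<^sup>2"
      using that assms by (simp add: abs_le_square_iff[symmetric])
    then show ?thesis using B'[of x] by (simp add: flat_def)
  qed
  have "B x = B (- e)" if "x \<le> - e" for x
  proof (cases "x = - e")
    case False
    with that have "x < - e" by simp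
    then show ?thesis
      by (rule DERIV_isconst_end[symmetric])
        (auto intro!: outside DERIV_isCont continuous_at_imp_continuous_on B')
  qed simp
  moreover have "B x = B e" if "e \<le> x" for x
  proof (cases "x = e")
    case False
    with that have "e < x" by simp
    then show ?thesis
      by (rule DERIV_isconst_end)
        (auto intro!: outside DERIV_isCont continuous_at_imp_continuous_on B')
  qed simp
  ultimately show ?thesis using B' that by blast
qed

text \<open>The difference of two translates of one transition function: to the left of both transitions
  the two values \<open>B (- e)\<close> cancel, to the right of both the two values \<open>B e\<close>, so the support is
  compact although \<open>B\<close> itself does not vanish on the right.\<close>

lemma test_function_bump_difference:
  fixes e s t :: real
  assumes e: "e > 0" and s: "e < s" "s + e < 1" and t: "e < t" "t + e < 1"
  obtains \<phi> where "test_function \<phi>"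
    "\<And>x. deriv \<phi> x = flat 0 (e\<^sup>2 - (x - s)\<^sup>2) - flat 0 (e\<^sup>2 - (x - t)\<^sup>2)"
proof -
  from smooth_transition_exists[OF e] obtain B where
    B': "\<And>x. (B has_real_derivative flat 0 (e\<^sup>2 - x\<^sup>2)) (at x)"
    and left: "\<And>x. x \<le> - e \<Longrightarrow> B x = B (- e)"
    and right: "\<And>x. e \<le> x \<Longrightarrow> B x = B e" by blast
  define \<phi> where "\<phi> x = B (x - s) - B (x - t)" for x
  \<comment> \<open>Differences of translates of functions in \<open>A\<close> form the derivative-closed set that contains
    \<open>\<phi>\<close>; translating and subtracting commute with differentiation.\<close>
  define A where "A = insert B (bump_terms e)"
  have base: "(\<lambda>x. flat 0 (e\<^sup>2 - x\<^sup>2)) \<in> A"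
    by (simp add: A_def bump_in_bump_terms)
  have A: "\<exists>g'\<in>A. \<forall>x. (g has_real_derivative g' x) (at x)" if "g \<in> A" for g
  proof (cases "g = B")
    case True
    with B' show ?thesis by (intro bexI[OF _ base]) simp
  next
    case False
    with that have "g \<in> bump_terms e" by (simp add: A_def)
    from bump_terms_deriv_closed[OF this] show ?thesis unfolding A_def by blast
  qed
  have shift: "((\<lambda>x. g (x - s) - g (x - t)) has_real_derivative g' (x - s) - g' (x - t)) (at x)"
    if "\<And>x. (g has_real_derivative g' x) (at x)" for g g' :: "real \<Rightarrow> real" and x
    by (auto intro!: derivative_eq_intros DERIV_chain2[OF that])
  have smooth: "(deriv ^^ n) \<phi> field_differentiable at y" for n y
  proof (rule deriv_closed_imp_smooth[of _ "(\<lambda>g x. g (x - s) - g (x - t)) ` A"])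
    show "\<phi> \<in> (\<lambda>g x. g (x - s) - g (x - t)) ` A"
      by (auto simp: \<phi>_def A_def fun_eq_iff)
  next
    fix h assume "h \<in> (\<lambda>g x. g (x - s) - g (x - t)) ` A"
    then obtain g where g: "g \<in> A" "h = (\<lambda>x. g (x - s) - g (x - t))" by blast
    from A[OF g(1)] obtain g' where "g' \<in> A" "\<forall>x. (g has_real_derivative g' x) (at x)" by blast
    with shift[of g g'] g(2)
    show "\<exists>h'\<in>(\<lambda>g x. g (x - s) - g (x - t)) ` A. \<forall>x. (h has_real_derivative h' x) (at x)"
      by auto
  qed
  have zero: "\<phi> x = 0" if "x < min s t - e \<or> max s t + e < x" for x
    using that left[of "x - s"] left[of "x - t"] right[of "x - s"] right[of "x - t"]
    by (auto simp: \<phi>_def)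
  have "{x. \<phi> x \<noteq> 0} \<subseteq> {min s t - e..max s t + e}"
    using zero by (force simp: not_less)
  then have "closure {x. \<phi> x \<noteq> 0} \<subseteq> {min s t - e..max s t + e}"
    by (rule closure_minimal) simp
  also have "\<dots> \<subseteq> {0<..<1}"
    using s t by auto
  finally have "test_function \<phi>"
    using smooth by (simp add: test_function_def)
  moreover have "deriv \<phi> x = flat 0 (e\<^sup>2 - (x - s)\<^sup>2) - flat 0 (e\<^sup>2 - (x - t)\<^sup>2)" for x
    unfolding \<phi>_def[abs_def] by (rule DERIV_imp_deriv[OF shift[OF B']])
  ultimately show ?thesis using that by blast
qed

section \<open>Test functions and weak derivatives\<close>

lemma test_function_DERIV:
  assumes "test_function \<phi>"
  shows "(\<phi> has_real_derivative deriv \<phi> y) (at y)"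
proof -
  have "(deriv ^^ 0) \<phi> field_differentiable at y"
    using assms unfolding test_function_def by blast
  then show ?thesis by (simp add: field_differentiable_derivI)
qed

lemma test_function_boundary:
  assumes "test_function \<phi>"
  shows "\<phi> 0 = 0" "\<phi> 1 = 0"
  using assms closure_subset[of "{y. \<phi> y \<noteq> 0}"] unfolding test_function_def by fastforce+

lemma test_function_deriv:
  assumes "test_function \<phi>"
  shows "test_function (deriv \<phi>)"
proof -
  have "deriv \<phi> y = 0" if "y \<notin> closure {y. \<phi> y \<noteq> 0}" for y
  proof -
    have "((\<lambda>_. 0) has_real_derivative 0) (at y)" by simp
    then have "(\<phi> has_real_derivative 0) (at y)"
      by (rule has_field_derivative_transform_within_open[of _ _ _ "- closure {y. \<phi> y \<noteq> 0}"])
         (use that closure_subset[of "{y. \<phi> y \<noteq> 0}"] in auto)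
    then show ?thesis by (rule DERIV_imp_deriv)
  qed
  then have "closure {y. deriv \<phi> y \<noteq> 0} \<subseteq> closure {y. \<phi> y \<noteq> 0}"
    by (intro closure_minimal) auto
  moreover have "(deriv ^^ n) (deriv \<phi>) field_differentiable at y" for n y
  proof -
    have "(deriv ^^ Suc n) \<phi> field_differentiable at y"
      using assms unfolding test_function_def by blast
    then show ?thesis by (simp add: funpow_swap1)
  qed
  ultimately show ?thesis
    using assms unfolding test_function_def by blast
qed

lemma test_function_continuous:
  assumes "test_function \<phi>"
  shows "continuous_on S \<phi>"
  using test_function_DERIV[OF assms]
  by (blast intro: DERIV_isCont continuous_at_imp_continuous_on)

lemma LINT_unit_eq_integral:
  fixes g :: "real \<Rightarrow> real"
  assumes "continuous_on {0..1} g"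
  shows "(LINT y|lebesgue_on {0..1}. g y) = integral {0..1} g"
  by (rule lebesgue_integral_eq_integral[OF continuous_imp_integrable_real[OF assms]]) simp

lemma continuous_imp_square_integrable:
  assumes "continuous_on {0..1} g"
  shows "square_integrable g"
  unfolding square_integrable_def
  using continuous_imp_integrable_real[OF assms]
  by (auto intro!: continuous_imp_integrable_real continuous_intros assms
      dest: borel_measurable_integrable)

text \<open>Integration by parts: \<open>v \<phi>\<close> vanishes at both end points, so its derivative
  \<open>v \<phi>' + g \<phi>\<close> has integral zero.\<close>

lemma weak_deriv_C1:
  fixes v g :: "real \<Rightarrow> real"
  assumes v: "\<And>y. y \<in> {0..1} \<Longrightarrow> (v has_real_derivative g y) (at y within {0..1})"
    and g: "continuous_on {0..1} g"
  shows "weak_deriv_L2 v g"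
  unfolding weak_deriv_L2_def
proof (intro conjI allI impI)
  show "square_integrable g" by (rule continuous_imp_square_integrable[OF g])
next
  fix \<phi> assume \<phi>: "test_function \<phi>"
  have cv: "continuous_on {0..1} v"
    by (rule DERIV_continuous_on[OF v])
  have c1: "continuous_on {0..1} (\<lambda>y. v y * deriv \<phi> y)"
    by (intro continuous_intros cv test_function_continuous test_function_deriv \<phi>)
  have c2: "continuous_on {0..1} (\<lambda>y. g y * \<phi> y)"
    by (intro continuous_intros g test_function_continuous \<phi>)
  have "((\<lambda>y. v y * deriv \<phi> y + g y * \<phi> y) has_integral v 1 * \<phi> 1 - v 0 * \<phi> 0) {0..1}"
  proof (rule fundamental_theorem_of_calculus)
    fix y :: real assume "y \<in> {0..1}"
    then show "((\<lambda>y. v y * \<phi> y) has_vector_derivative v y * deriv \<phi> y + g y * \<phi> y)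
        (at y within {0..1})"
      unfolding has_real_derivative_iff_has_vector_derivative[symmetric]
      by (auto intro!: derivative_eq_intros v
          has_field_derivative_at_within[OF test_function_DERIV[OF \<phi>]])
  qed simp
  then have "integral {0..1} (\<lambda>y. v y * deriv \<phi> y + g y * \<phi> y) = 0"
    by (simp add: integral_unique test_function_boundary[OF \<phi>])
  then have "integral {0..1} (\<lambda>y. v y * deriv \<phi> y) + integral {0..1} (\<lambda>y. g y * \<phi> y) = 0"
    by (simp add: Henstock_Kurzweil_Integration.integral_add integrable_continuous_real c1 c2)
  then show "(LINT y|lebesgue_on {0..1}. v y * deriv \<phi> y) = - (LINT y|lebesgue_on {0..1}. g y * \<phi> y)"
    by (simp add: LINT_unit_eq_integral c1 c2)
qed

text \<open>The square of \<open>g\<close> is continuous and nonnegative with integral zero.\<close>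

lemma continuous_AE_zero_imp_zero:
  fixes g :: "real \<Rightarrow> real"
  assumes g: "continuous_on {0..1} g" and ae: "AE y in lebesgue_on {0..1}. g y = 0"
    and y: "y \<in> {0..1}"
  shows "g y = 0"
proof -
  have c: "continuous_on {0..1} (\<lambda>y. (g y)\<^sup>2)"
    by (intro continuous_intros g)
  have "AE y in lebesgue_on {0..1}. (g y)\<^sup>2 = 0"
    using ae by eventually_elim simp
  then have "integral {0..1} (\<lambda>y. (g y)\<^sup>2) = 0"
    using integral_eq_zero_AE LINT_unit_eq_integral[OF c] by metis
  then show ?thesis
    using integral_eq_0_iff[of 0 1 "\<lambda>y. (g y)\<^sup>2"] c y by auto
qed

text \<open>If \<open>w s > w t\<close>, choose \<open>m\<close> strictly between the two values and a test function whose derivative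
  is a narrow bump at \<open>s\<close> minus a narrow bump at \<open>t\<close>. On the first bump \<open>w > m\<close>, on the second
  \<open>w < m\<close>, so \<open>(w - m) \<phi>'\<close> is nonnegative and positive at \<open>s\<close>. Its integral is nevertheless zero,
  by hypothesis for the part with \<open>w\<close> and because \<open>\<phi>\<close> vanishes at the end points for the part
  with \<open>m\<close>.\<close>

lemma du_Bois_Reymond:
  fixes w :: "real \<Rightarrow> real"
  assumes w: "continuous_on {0..1} w"
    and weak: "\<And>\<phi>. test_function \<phi> \<Longrightarrow> (LINT y|lebesgue_on {0..1}. w y * deriv \<phi> y) = 0"
  obtains c where "\<And>y. y \<in> {0..1} \<Longrightarrow> w y = c"
proof -
  have le: "w s \<le> w t" if s: "s \<in> {0<..<1}" and t: "t \<in> {0<..<1}" for s t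
  proof (rule ccontr)
    assume "\<not> w s \<le> w t"
    define m where "m = (w s + w t) / 2"
    have m: "w t < m" "m < w s" using \<open>\<not> w s \<le> w t\<close> by (auto simp: m_def)
    have cont: "isCont w s" "isCont w t"
      using s t w by (auto intro!: continuous_on_interior[of "{0..1}"])
    obtain d1 where d1: "d1 > 0" "\<And>y. \<bar>y - s\<bar> < d1 \<Longrightarrow> m < w y"
      using order_tendstoD(1)[OF cont(1)[unfolded isCont_def] m(2)] m(2)
      by (auto simp: eventually_at dist_real_def) metis
    obtain d2 where d2: "d2 > 0" "\<And>y. \<bar>y - t\<bar> < d2 \<Longrightarrow> w y < m"
      using order_tendstoD(2)[OF cont(2)[unfolded isCont_def] m(1)] m(1)
      by (auto simp: eventually_at dist_real_def) metis
    \<comment> \<open>The halves keep the closed supports of both bumps inside the open interval.\<close>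
    define e where "e = Min {d1, d2, s / 2, t / 2, (1 - s) / 2, (1 - t) / 2}"
    have "e \<le> d1" "e \<le> d2" "e \<le> s / 2" "e \<le> t / 2" "e \<le> (1 - s) / 2" "e \<le> (1 - t) / 2"
      by (simp_all only: e_def) (rule Min_le; simp)+
    moreover have "e > 0"
      unfolding e_def using s t d1(1) d2(1) by simp
    ultimately have e: "e > 0" "e \<le> d1" "e \<le> d2" "e < s" "s + e < 1" "e < t" "t + e < 1"
      using s t by auto
    define b where "b x = flat 0 (e\<^sup>2 - x\<^sup>2)" for x
    have b_pos: "b x > 0 \<longleftrightarrow> \<bar>x\<bar> < e" for x
      using e(1) abs_le_square_iff[of e x] by (auto simp: b_def flat_pos_iff)
    have b_nonneg: "b x \<ge> 0" for x by (simp add: b_def flat_nonneg)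
    obtain \<phi> where \<phi>: "test_function \<phi>" "\<And>x. deriv \<phi> x = b (x - s) - b (x - t)"
      using test_function_bump_difference[OF e(1,4,5,6,7)] unfolding b_def by metis
    have c': "continuous_on {0..1} (deriv \<phi>)"
      by (intro test_function_continuous test_function_deriv \<phi>)
    have c: "continuous_on {0..1} (\<lambda>y. w y * deriv \<phi> y)"
      by (intro continuous_intros w c')
    have "integral {0..1} (\<lambda>y. w y * deriv \<phi> y) = 0"
      using weak[OF \<phi>(1)] LINT_unit_eq_integral[OF c] by simp
    moreover have "(deriv \<phi> has_integral \<phi> 1 - \<phi> 0) {0..1}"
      by (rule fundamental_theorem_of_calculus)
        (auto simp: has_real_derivative_iff_has_vector_derivative[symmetric]
          intro!: has_field_derivative_at_within test_function_DERIV \<phi>)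
    then have "integral {0..1} (deriv \<phi>) = 0"
      by (simp add: integral_unique test_function_boundary[OF \<phi>(1)])
    moreover have "integral {0..1} (\<lambda>y. w y * deriv \<phi> y - m * deriv \<phi> y)
        = integral {0..1} (\<lambda>y. w y * deriv \<phi> y) - integral {0..1} (\<lambda>y. m * deriv \<phi> y)"
      by (intro Henstock_Kurzweil_Integration.integral_diff integrable_continuous_real
          continuous_intros w c')
    ultimately have "integral {0..1} (\<lambda>y. (w y - m) * deriv \<phi> y) = 0"
      by (simp add: left_diff_distrib)
    moreover have "continuous_on {0..1} (\<lambda>y. (w y - m) * deriv \<phi> y)"
      by (intro continuous_intros w c')
    moreover have nonneg: "(w y - m) * b (y - s) \<ge> 0" "(w y - m) * b (y - t) \<le> 0" for y
    proof -
      show "(w y - m) * b (y - s) \<ge> 0"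
        using b_nonneg[of "y - s"] b_pos[of "y - s"] d1(2)[of y] e(2)
        by (cases "b (y - s) = 0") auto
      show "(w y - m) * b (y - t) \<le> 0"
        using b_nonneg[of "y - t"] b_pos[of "y - t"] d2(2)[of y] e(3)
        by (cases "b (y - t) = 0") (auto simp: mult_le_0_iff)
    qed
    then have "(w y - m) * deriv \<phi> y \<ge> 0" for y
      using order_trans[OF nonneg(2)[of y] nonneg(1)[of y]] by (simp add: \<phi>(2) right_diff_distrib)
    ultimately have "(w s - m) * deriv \<phi> s = 0"
      using integral_eq_0_iff[of 0 1 "\<lambda>y. (w y - m) * deriv \<phi> y"] s by auto
    then have "(w s - m) * b (s - s) = (w s - m) * b (s - t)"
      by (simp only: \<phi>(2) right_diff_distrib)
    also have "\<dots> \<le> 0" by (rule nonneg(2))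
    finally show False
      using m b_pos[of 0] e(1) by (simp add: mult_le_0_iff not_le[symmetric])
  qed
  \<comment> \<open>Continuity carries the constancy from the open interval to its end points.\<close>
  have "w y = w (1/2)" if "y \<in> {0..1}" for y
  proof (rule continuous_constant_on_closure[of "{0<..<1}" w])
    show "continuous_on (closure {0<..<1}) w" using w by simp
    show "y \<in> closure {0<..<1}" using that by simp
    show "w x = w (1/2)" if "x \<in> {0<..<1}" for x
      using le[of x "1/2"] le[of "1/2" x] that by simp
  qed
  then show ?thesis using that by blast
qed

lemma weak_deriv_L2_cong_AE:
  assumes "weak_deriv_L2 v g" and h: "continuous_on {0..1} h"
    and ae: "AE y in lebesgue_on {0..1}. g y = h y"
  shows "weak_deriv_L2 v h"
  unfolding weak_deriv_L2_def
proof (intro conjI allI impI)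
  show sq: "square_integrable h" by (rule continuous_imp_square_integrable[OF h])
  fix \<phi> assume \<phi>: "test_function \<phi>"
  have meas: "g \<in> borel_measurable (lebesgue_on {0..1})" "h \<in> borel_measurable (lebesgue_on {0..1})"
    "\<phi> \<in> borel_measurable (lebesgue_on {0..1})"
    using assms(1) sq continuous_imp_square_integrable[OF test_function_continuous[OF \<phi>]]
    by (auto simp: weak_deriv_L2_def square_integrable_def)
  have "(LINT y|lebesgue_on {0..1}. g y * \<phi> y) = (LINT y|lebesgue_on {0..1}. h y * \<phi> y)"
    by (rule integral_cong_AE) (use ae meas in auto)
  then show "(LINT y|lebesgue_on {0..1}. v y * deriv \<phi> y) = - (LINT y|lebesgue_on {0..1}. h y * \<phi> y)"
    using assms(1) \<phi> by (simp add: weak_deriv_L2_def)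
qed

lemma weak_deriv_constant_imp_affine:
  fixes v :: "real \<Rightarrow> real"
  assumes v: "continuous_on {0..1} v" and weak: "weak_deriv_L2 v (\<lambda>_. k)"
    and y: "y \<in> {0..1}"
  shows "v y = v 0 + k * y"
proof -
  have lin: "weak_deriv_L2 (\<lambda>y. k * y) (\<lambda>_. k)"
    by (rule weak_deriv_C1) (auto intro!: derivative_eq_intros)
  obtain c where c: "\<And>y. y \<in> {0..1} \<Longrightarrow> v y - k * y = c"
  proof (rule du_Bois_Reymond[of "\<lambda>y. v y - k * y"])
    show "continuous_on {0..1} (\<lambda>y. v y - k * y)"
      by (intro continuous_intros v)
    fix \<phi> assume \<phi>: "test_function \<phi>"
    have c': "continuous_on {0..1} (deriv \<phi>)"
      by (intro test_function_continuous test_function_deriv \<phi>)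
    have int: "integrable (lebesgue_on {0..1}) (\<lambda>y. v y * deriv \<phi> y)"
      "integrable (lebesgue_on {0..1}) (\<lambda>y. k * y * deriv \<phi> y)"
      by (intro continuous_imp_integrable_real continuous_intros v c')+
    show "(LINT y|lebesgue_on {0..1}. (v y - k * y) * deriv \<phi> y) = 0"
      using weak lin \<phi> int by (simp add: weak_deriv_L2_def left_diff_distrib)
  qed blast
  from c[of 0] c[OF y] show ?thesis by simp
qed

section \<open>Algebraic equilibrium relations\<close>

lemma positive_quadratic_root:
  fixes \<nu> x d :: real
  assumes "\<nu> > 0" "x > 0" "\<nu> * x\<^sup>2 + x = d"
  shows "x = (sqrt (1 + 4 * \<nu> * d) - 1) / (2 * \<nu>)"
proof -
  have "1 + 4 * \<nu> * d = (2 * \<nu> * x + 1)\<^sup>2"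
    unfolding assms(3)[symmetric] by (simp add: power2_eq_square algebra_simps)
  then have "sqrt (1 + 4 * \<nu> * d) = 2 * \<nu> * x + 1"
    using assms by simp
  then show ?thesis using assms by simp
qed

text \<open>In absolute value, the second relation reads \<open>(1 + \<nu> x) (\<eta> x / G + 1) = \<xi> \<bar>C\<bar>\<close>, with a left-hand side
  that increases strictly on the positive axis; so \<open>C\<close> determines the fluidity \<open>x\<close>, and then the
  signed relation determines the stress \<open>s\<close>.\<close>

lemma stress_fluidity_determined:
  fixes \<eta> G \<xi> \<nu> C x y s t :: real
  assumes pos: "\<eta> > 0" "G > 0" "\<xi> > 0" "\<nu> > 0" "x > 0" "y > 0"
    and x: "\<xi> * \<bar>s\<bar> = 1 + \<nu> * x" "\<eta> * (x * s / G) + s = C"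
    and y: "\<xi> * \<bar>t\<bar> = 1 + \<nu> * y" "\<eta> * (y * t / G) + t = C"
  shows "s = t \<and> x = y"
proof -
  have Cx: "C = s * (\<eta> * x / G + 1)" and Cy: "C = t * (\<eta> * y / G + 1)"
    using x(2) y(2) by (simp_all add: algebra_simps)
  have p: "\<eta> * x / G + 1 > 0" "\<eta> * y / G + 1 > 0" using pos by (simp_all add: add_pos_pos)
  have abs: "\<xi> * \<bar>C\<bar> = (1 + \<nu> * x) * (\<eta> * x / G + 1)" "\<xi> * \<bar>C\<bar> = (1 + \<nu> * y) * (\<eta> * y / G + 1)"
    unfolding x(1)[symmetric] y(1)[symmetric] using p
    by (simp add: Cx abs_mult, simp add: Cy abs_mult)
  have mono: "(1 + \<nu> * a) * (\<eta> * a / G + 1) < (1 + \<nu> * b) * (\<eta> * b / G + 1)"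
    if "0 < a" "a < b" for a b
    using that pos by (intro mult_strict_mono) (auto simp: divide_strict_right_mono intro!: add_pos_pos)
  have "x = y"
    using mono[of x y] mono[of y x] abs pos by (cases x y rule: linorder_cases) auto
  then show ?thesis using Cx Cy p by auto
qed

section \<open>Stationary solutions\<close>

lemma affine_in_H1:
  assumes "\<And>y. y \<in> {0..1} \<Longrightarrow> v y = p * y + q"
  shows "v \<in> H1" and "weak_deriv_L2 v (\<lambda>_. p)"
proof -
  have c: "continuous_on {0..1} v"
    using assms by (subst continuous_on_cong[OF refl assms]) (auto intro!: continuous_intros)
  have "((\<lambda>y. p * y + q) has_real_derivative p) (at y within {0..1})" for y
    by (auto intro!: derivative_eq_intros)
  then have "(v has_real_derivative p) (at y within {0..1})" if "y \<in> {0..1}" for y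
    by (rule has_field_derivative_transform_within[of _ _ _ _ 1]) (use that assms in auto)
  then show w: "weak_deriv_L2 v (\<lambda>_. p)"
    by (intro weak_deriv_C1) auto
  show "v \<in> H1"
    using c w continuous_imp_square_integrable[OF c] by (auto simp: H1_def)
qed

theorem lemma4p1:
  fixes \<rho> \<eta> lam G \<xi> \<nu> a :: real
    and u \<tau> f :: "real \<Rightarrow> real"
  assumes "\<rho> > 0" and "\<eta> > 0" and "lam > 0" and "G > 0" and "\<xi> > 0" and "\<nu> > 0"
    and "a > 0"
  shows "(u \<in> H1 \<and> \<tau> \<in> H1 \<and> f \<in> H1 \<and>
          stationary_solution \<rho> \<eta> lam G \<xi> \<nu> u \<tau> f \<and>
          u 0 = 0 \<and> u 1 = a \<and> (\<forall>y\<in>{0..1}. f y > 0))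
    \<longleftrightarrow> (\<forall>y\<in>{0..1}.
          u y = a * y \<and>
          \<tau> y = (sqrt (1 + 4 * \<nu> * \<xi> * G * a) + 1) / (2 * \<xi>) \<and>
          f y = (sqrt (1 + 4 * \<nu> * \<xi> * G * a) - 1) / (2 * \<nu>))"
    (is "?stationary \<longleftrightarrow> ?explicit")
proof
  assume st: ?stationary
  have u: "continuous_on {0..1} u" and \<tau>: "continuous_on {0..1} \<tau>" and f: "continuous_on {0..1} f"
    and f_pos: "\<And>y. y \<in> {0..1} \<Longrightarrow> f y > 0" and bd: "u 0 = 0" "u 1 = a"
    using st by (auto simp: H1_def)
  from st have momentum: "\<eta> * (LINT y|lebesgue_on {0..1}. u y * deriv (deriv \<phi>) y)
      - (LINT y|lebesgue_on {0..1}. \<tau> y * deriv \<phi> y) = 0" if "test_function \<phi>" for \<phi>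
    using that by (auto simp: stationary_solution_def satisfies_system_def)
  define h where "h y = f y * \<tau> y / G" for y
  have h: "continuous_on {0..1} h"
    unfolding h_def using \<open>G > 0\<close> by (intro continuous_intros f \<tau>) auto
  have weak_u: "weak_deriv_L2 u h"
  proof -
    from st obtain u' where u': "weak_deriv_L2 u u'"
      "AE y in lebesgue_on {0..1}. 0 = G * u' y - f y * \<tau> y"
      by (auto simp: stationary_solution_def satisfies_system_def)
    show ?thesis
    proof (rule weak_deriv_L2_cong_AE[OF u'(1) h])
      show "AE y in lebesgue_on {0..1}. u' y = h y"
        using u'(2) by eventually_elim (use \<open>G > 0\<close> in \<open>simp add: h_def field_simps\<close>)
    qed
  qed
  \<comment> \<open>The momentum balance, integrated once: total stress is constant.\<close>
  obtain C where C: "\<And>y. y \<in> {0..1} \<Longrightarrow> \<eta> * h y + \<tau> y = C"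
  proof (rule du_Bois_Reymond[of "\<lambda>y. \<eta> * h y + \<tau> y"])
    show "continuous_on {0..1} (\<lambda>y. \<eta> * h y + \<tau> y)"
      by (intro continuous_intros h \<tau>)
    fix \<phi> assume \<phi>: "test_function \<phi>"
    have c': "continuous_on {0..1} (deriv \<phi>)"
      by (intro test_function_continuous test_function_deriv \<phi>)
    have int: "integrable (lebesgue_on {0..1}) (\<lambda>y. h y * deriv \<phi> y)"
      "integrable (lebesgue_on {0..1}) (\<lambda>y. \<tau> y * deriv \<phi> y)"
      by (intro continuous_imp_integrable_real continuous_intros h \<tau> c')+
    have "(LINT y|lebesgue_on {0..1}. u y * deriv (deriv \<phi>) y)
        = - (LINT y|lebesgue_on {0..1}. h y * deriv \<phi> y)"
      using weak_u test_function_deriv[OF \<phi>] by (simp add: weak_deriv_L2_def)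
    with momentum[OF \<phi>] int
    show "(LINT y|lebesgue_on {0..1}. (\<eta> * h y + \<tau> y) * deriv \<phi> y) = 0"
      by (simp add: distrib_right mult.assoc)
  qed blast
  have fluidity: "\<xi> * \<bar>\<tau> y\<bar> = 1 + \<nu> * f y" if y: "y \<in> {0..1}" for y
  proof -
    have "(-1 + \<xi> * \<bar>\<tau> y\<bar>) * (f y)\<^sup>2 - \<nu> * (f y) ^ 3 = 0"
    proof (rule continuous_AE_zero_imp_zero[OF _ _ y])
      show "continuous_on {0..1} (\<lambda>y. (-1 + \<xi> * \<bar>\<tau> y\<bar>) * (f y)\<^sup>2 - \<nu> * (f y) ^ 3)"
        by (intro continuous_intros f \<tau>)
      show "AE y in lebesgue_on {0..1}. (-1 + \<xi> * \<bar>\<tau> y\<bar>) * (f y)\<^sup>2 - \<nu> * (f y) ^ 3 = 0"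
        using st unfolding stationary_solution_def satisfies_system_def
        by (simp only: eq_commute[of 0 "_ - _ :: real"])
    qed
    then have "(f y)\<^sup>2 * (-1 + \<xi> * \<bar>\<tau> y\<bar> - \<nu> * f y) = 0"
      by (simp add: algebra_simps power2_eq_square power3_eq_cube)
    then show ?thesis using f_pos[OF y] by simp
  qed
  have const: "\<tau> y = \<tau> 0 \<and> f y = f 0" if y: "y \<in> {0..1}" for y
    by (rule stress_fluidity_determined[of \<eta> G \<xi> \<nu> "f y" "f 0" "\<tau> y" C "\<tau> 0"])
      (use assms y f_pos fluidity C in \<open>auto simp: h_def[symmetric]\<close>)
  have h_const: "h y = h 0" if "y \<in> {0..1}" for y
    using const[OF that] by (simp only: h_def)
  have "AE y in lebesgue_on {0..1}. h y = h 0"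
    by (rule AE_I2) (rule h_const, simp)
  then have "weak_deriv_L2 u (\<lambda>_. h 0)"
    by (intro weak_deriv_L2_cong_AE[OF weak_u] continuous_intros)
  then have u_eq: "u y = h 0 * y" if "y \<in> {0..1}" for y
    using weak_deriv_constant_imp_affine[OF u _ that] bd by simp
  then have "h 0 = a" using u_eq[of 1] bd by simp
  then have stress: "f 0 * \<tau> 0 = G * a" using \<open>G > 0\<close> by (simp add: h_def field_simps)
  moreover have "f 0 > 0" by (rule f_pos) simp
  moreover have "G * a > 0" using \<open>G > 0\<close> \<open>a > 0\<close> by simp
  ultimately have "\<tau> 0 > 0" by (metis zero_less_mult_pos)
  with fluidity[of 0] have \<tau>0: "\<xi> * \<tau> 0 = 1 + \<nu> * f 0" by simp
  then have "\<nu> * (f 0)\<^sup>2 + f 0 = \<xi> * (f 0 * \<tau> 0)"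
    by (simp only: mult.left_commute[of \<xi>]) (simp add: power2_eq_square algebra_simps)
  then have f0: "f 0 = (sqrt (1 + 4 * \<nu> * \<xi> * G * a) - 1) / (2 * \<nu>)"
    using positive_quadratic_root[OF \<open>\<nu> > 0\<close> f_pos[of 0]] stress by (simp add: mult.assoc)
  then have "2 * \<nu> * f 0 = sqrt (1 + 4 * \<nu> * \<xi> * G * a) - 1"
    using \<open>\<nu> > 0\<close> by simp
  then have "2 * \<xi> * \<tau> 0 = sqrt (1 + 4 * \<nu> * \<xi> * G * a) + 1"
    using \<tau>0 by linarith
  then have "\<tau> 0 = (sqrt (1 + 4 * \<nu> * \<xi> * G * a) + 1) / (2 * \<xi>)"
    using \<open>\<xi> > 0\<close> by (simp add: nonzero_eq_divide_eq mult.commute)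
  with f0 show ?explicit
    using u_eq[unfolded \<open>h 0 = a\<close>] const by metis
next
  assume ex: ?explicit
  define r where "r = sqrt (1 + 4 * \<nu> * \<xi> * G * a)"
  define T where "T = (r + 1) / (2 * \<xi>)"
  define F where "F = (r - 1) / (2 * \<nu>)"
  have u: "u y = a * y" and \<tau>: "\<tau> y = T" and f: "f y = F" if "y \<in> {0..1}" for y
    using ex that by (auto simp: T_def F_def r_def)
  have prod_pos: "4 * \<nu> * \<xi> * G * a > 0" using assms by simp
  then have "r > 1" unfolding r_def by (simp only: real_less_rsqrt power_one less_add_same_cancel1)
  then have "F > 0" "T > 0" using assms by (simp_all add: F_def T_def)
  have r2: "r\<^sup>2 = 1 + 4 * \<nu> * \<xi> * G * a"
    unfolding r_def by (rule real_sqrt_pow2) (use prod_pos in linarith)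
  have FT: "F * T = G * a"
  proof -
    have "F * T = (r\<^sup>2 - 1) / (4 * \<nu> * \<xi>)"
      by (simp add: F_def T_def power2_eq_square algebra_simps)
    then show ?thesis using assms by (simp add: r2)
  qed
  have fluidity: "\<xi> * T = 1 + \<nu> * F"
    using assms by (simp add: F_def T_def field_simps)
  have H1: "u \<in> H1" "\<tau> \<in> H1" "f \<in> H1" and weak_u: "weak_deriv_L2 u (\<lambda>_. a)"
    and weak_\<tau>: "weak_deriv_L2 \<tau> (\<lambda>_. 0)"
    using affine_in_H1[of u a 0] affine_in_H1[of \<tau> 0 T] affine_in_H1[of f 0 F] u \<tau> f by simp_all
  have momentum: "\<eta> * (LINT y|lebesgue_on {0..1}. u y * deriv (deriv \<phi>) y)
      - (LINT y|lebesgue_on {0..1}. \<tau> y * deriv \<phi> y) = 0" if \<phi>: "test_function \<phi>" for \<phi>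
  proof -
    have "weak_deriv_L2 (\<lambda>_. a) (\<lambda>_. 0)"
      using affine_in_H1(2)[of "\<lambda>_. a" 0 a] by simp
    then show ?thesis
      using weak_u weak_\<tau> \<phi> test_function_deriv[OF \<phi>] by (simp add: weak_deriv_L2_def)
  qed
  have "stationary_solution \<rho> \<eta> lam G \<xi> \<nu> u \<tau> f"
    unfolding stationary_solution_def satisfies_system_def
  proof (intro conjI allI impI exI[of _ "\<lambda>_. a"] weak_u)
    show "AE y in lebesgue_on {0..1}. lam * 0 = G * a - f y * \<tau> y"
      by (auto intro!: AE_I2 simp: f \<tau> FT)
    show "AE y in lebesgue_on {0..1}. 0 = (- 1 + \<xi> * \<bar>\<tau> y\<bar>) * (f y)\<^sup>2 - \<nu> * f y ^ 3"
      using \<open>T > 0\<close> by (auto intro!: AE_I2 simp: f \<tau> fluidity power2_eq_square power3_eq_cube)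
  qed (use momentum in simp)
  then show ?stationary using H1 u f \<open>F > 0\<close> by simp
qed

end
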